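(* Let $k\ge1$. A function $f:\mathbb{N}^k\to\mathbb{N}$ can be computed by a finite, directed acyclic abelian network of adders, splitters, presinks and delayers if and only if all of the following hold: (i) $f(\mathbf{0})=0$; (ii) $f$ is increasing; (iii) $f=L+P$ for an $\mathbb{N}$-linear function $L$ and an eventually constant function $P$.
   Context: $\mathbb{N}=\{0,1,2,\dots\}$; $f$ is increasing if $\mathbf{x}\le\mathbf{y}$ coordinatewise implies $f(\mathbf{x})\le f(\mathbf{y})$. $L$ is $\mathbb{N}$-linear if $L(\mathbf{x})=\mathbf{b}\cdot\mathbf{x}$ with $\mathbf{b}\in\mathbb{N}^k$. $P:\mathbb{N}^k\to\mathbb{Q}$ is eventually constant if there exist $r_1,\dots,r_k\in\mathbb{N}$ with $P(\mathbf{x})=P(\mathbf{x}+\mathbf{e}_i)$ whenever $x_i\ge r_i$ ($\mathbf{e}_i$ the $i$th standard basis vector). An adder (one state, two inputs, one output) computes $(x,y)\mapsto x+y$; a splitter (one state, one input, two outputs) computes $x\mapsto(x,x)$. A delayer has states $0,1$: in state $0$ a received letter moves it to state $1$ emitting nothing, in state $1$ it emits one letter per letter received. A presink has states $0,1$: in state $0$ a received letter moves it to state $1$ and it emits one letter, in state $1$ letters are ignored. (Gates may start in any state.) An abelian network is a finite directed multigraph with dangling input edges (no tail) and output/trash edges (no head), each node carrying a gate whose inputs/outputs are its incoming/outgoing edges; it runs by repeatedly feeding a waiting letter on any non-output, non-trash edge into the gate at its head, halting when all letters lie on output or trash edges. A directed acyclic network (no directed cycles) always halts and computes the function mapping the numbers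 of letters on its $k$ input edges to the number on its output edge. *)

theory Defs
  imports "HOL-Analysis.Analysis"
begin

text \<open>
  The space \<open>\<nat>^k\<close> is \<open>nat ^ 'k\<close> with \<open>'k\<close> an arbitrary finite (hence nonempty) index type;
  its order is the coordinatewise one.
\<close>

definition nat_linear :: "(nat ^ 'k \<Rightarrow> nat) \<Rightarrow> bool" where
  "nat_linear L \<longleftrightarrow> (\<exists>b :: nat ^ 'k. \<forall>x. L x = (\<Sum>i\<in>UNIV. b $ i * x $ i))"

definition eventually_constant :: "(nat ^ 'k \<Rightarrow> rat) \<Rightarrow> bool" where
  "eventually_constant P \<longleftrightarrow>
     (\<exists>r :: nat ^ 'k. \<forall>x i. r $ i \<le> x $ i \<longrightarrow> P x = P (x + axis i 1))"

datatype gate = Adder | Splitter | Presink | Delayer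

fun num_inputs :: "gate \<Rightarrow> nat" where
  "num_inputs Adder = 2"
| "num_inputs Splitter = 1"
| "num_inputs Presink = 1"
| "num_inputs Delayer = 1"

fun num_outputs :: "gate \<Rightarrow> nat" where
  "num_outputs Adder = 1"
| "num_outputs Splitter = 2"
| "num_outputs Presink = 1"
| "num_outputs Delayer = 1"

fun states :: "gate \<Rightarrow> nat set" where
  "states Adder = {0}"
| "states Splitter = {0}"
| "states Presink = {0, 1}"
| "states Delayer = {0, 1}"

text \<open>
  Processing one letter in state \<open>s\<close>: the new state, and the number of letters emitted on
  each outgoing edge. All four gates treat their inputs alike and their outputs alike, so
  no distinction between the ports of a gate is needed.
\<close>

fun next_state :: "gate \<Rightarrow> nat \<Rightarrow> nat" where
  "next_state Adder s = s"
| "next_state Splitter s = s"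
| "next_state Presink s = 1"
| "next_state Delayer s = 1"

fun emits :: "gate \<Rightarrow> nat \<Rightarrow> nat" where
  "emits Adder s = 1"
| "emits Splitter s = 1"
| "emits Presink s = (if s = 0 then 1 else 0)"
| "emits Delayer s = (if s = 0 then 0 else 1)"

text \<open>
  A tail or head of \<open>None\<close> marks a dangling end. Nodes and edges are natural numbers,
  which is no restriction as both sets are finite.
\<close>

record 'k network =
  nodes :: "nat set"
  edges :: "nat set"
  tail_of :: "nat \<Rightarrow> nat option"
  head_of :: "nat \<Rightarrow> nat option"
  gate_at :: "nat \<Rightarrow> gate"
  initial_state :: "nat \<Rightarrow> nat"
  input_edge :: "'k \<Rightarrow> nat"
  output_edge :: nat

definition in_edges :: "('k, 'z) network_scheme \<Rightarrow> nat \<Rightarrow> nat set" where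
  "in_edges N v = {e \<in> edges N. head_of N e = Some v}"

definition out_edges :: "('k, 'z) network_scheme \<Rightarrow> nat \<Rightarrow> nat set" where
  "out_edges N v = {e \<in> edges N. tail_of N e = Some v}"

text \<open>
  The edges without a tail are exactly the input edges, one for each index. The edges without
  a head are the output edge and the trash edges. No edge has both ends dangling, so input
  edges are disjoint from output and trash edges.
\<close>

definition abelian_network :: "('k, 'z) network_scheme \<Rightarrow> bool" where
  "abelian_network N \<longleftrightarrow>
     finite (nodes N) \<and> finite (edges N) \<and>
     (\<forall>e\<in>edges N. set_option (tail_of N e) \<subseteq> nodes N \<and> set_option (head_of N e) \<subseteq> nodes N) \<and>
     (\<forall>e\<in>edges N. tail_of N e \<noteq> None \<or> head_of N e \<noteq> None) \<and>
     inj (input_edge N) \<and>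
     range (input_edge N) = {e \<in> edges N. tail_of N e = None} \<and>
     output_edge N \<in> edges N \<and> head_of N (output_edge N) = None \<and>
     (\<forall>v\<in>nodes N. card (in_edges N v) = num_inputs (gate_at N v) \<and>
                   card (out_edges N v) = num_outputs (gate_at N v) \<and>
                   initial_state N v \<in> states (gate_at N v))"

definition acyclic_network :: "('k, 'z) network_scheme \<Rightarrow> bool" where
  "acyclic_network N \<longleftrightarrow>
     acyclic {(u, v). \<exists>e\<in>edges N. tail_of N e = Some u \<and> head_of N e = Some v}"

text \<open>
  A configuration consists of the number of letters waiting on each edge and the state of
  each gate.
\<close>

type_synonym config = "(nat \<Rightarrow> nat) \<times> (nat \<Rightarrow> nat)"

definition initial_config :: "('k, 'z) network_scheme \<Rightarrow> nat ^ 'k \<Rightarrow> config" where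
  "initial_config N x =
     ((\<lambda>e. \<Sum>i\<in>{i. input_edge N i = e}. x $ i), initial_state N)"

inductive step :: "('k, 'z) network_scheme \<Rightarrow> config \<Rightarrow> config \<Rightarrow> bool"
  for N :: "('k, 'z) network_scheme" where
  "step N (w, s)
     (\<lambda>e'. (if e' = e then w e' - 1 else w e') +
           (if e' \<in> out_edges N v then emits (gate_at N v) (s v) else 0),
      s(v := next_state (gate_at N v) (s v)))"
  if "e \<in> edges N" and "head_of N e = Some v" and "0 < w e"

definition halted :: "('k, 'z) network_scheme \<Rightarrow> config \<Rightarrow> bool" where
  "halted N c \<longleftrightarrow> (\<nexists>c'. step N c c')"

text \<open>
  The letters are processed in an arbitrary order: no run may go on forever, and every run
  that has halted must have produced the value of the function.
\<close>

definition computes :: "('k, 'z) network_scheme \<Rightarrow> (nat ^ 'k \<Rightarrow> nat) \<Rightarrow> bool" where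
  "computes N f \<longleftrightarrow> (\<forall>x.
     (\<nexists>c. c 0 = initial_config N x \<and> (\<forall>n. step N (c n) (c (Suc n)))) \<and>
     (\<forall>c. (step N)\<^sup>*\<^sup>* (initial_config N x) c \<and> halted N c \<longrightarrow> fst c (output_edge N) = f x))"

end

theory Submission
  imports Defs
begin

text \<open>
  In an acyclic network the number of letters that ever pass along an edge does not depend on
  the order of processing: it is the solution of the equations that express the traffic on the
  outgoing edges of a gate by the traffic on its incoming edges. Hence the functions
  computed are those generated from the coordinates by \<open>+\<close>, \<open>min _ 1\<close> and truncated \<open>_ - 1\<close>,
  and each of the three operations preserves the three conditions. Conversely, if \<open>f = L + P\<close>
  with \<open>L x = \<Sum>i. b i * x i\<close> and \<open>P\<close> constant beyond \<open>r\<close>, then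
  \<open>f x = (\<Sum>i. b i * (x i - r i)) + f (min x r)\<close>. The second summand is a finite sum of
  indicators of up-sets, each of which is a disjunction of conjunctions of thresholds
  \<open>m \<le> x i\<close>, and on \<open>{0, 1}\<close>-valued functions disjunction and conjunction are
  \<open>min (a + b) 1\<close> and \<open>a + b - 1\<close>.
\<close>

section \<open>Flows\<close>

primrec gate_output :: "gate \<Rightarrow> nat \<Rightarrow> nat \<Rightarrow> nat" where
  "gate_output g s 0 = 0"
| "gate_output g s (Suc n) = gate_output g s n + emits g ((next_state g ^^ n) s)"

lemma gate_output_mono: "m \<le> n \<Longrightarrow> gate_output g s m \<le> gate_output g s n"
  by (rule lift_Suc_mono_le[of "gate_output g s"]) auto

lemma next_state_funpow:
  "(next_state g ^^ n) s = (if g \<in> {Adder, Splitter} \<or> n = 0 then s else 1)"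
  by (induction n) (cases g; auto)+

text \<open>The initial state matters: a presink started in state 1 is a constant zero and a delayer
  started in state 1 an identity wire. The constructions of networks rely on both.\<close>

lemma gate_output_eq:
  "s \<in> states g \<Longrightarrow> gate_output g s n =
     (case g of Adder \<Rightarrow> n | Splitter \<Rightarrow> n
      | Presink \<Rightarrow> if s = 0 then min n 1 else 0
      | Delayer \<Rightarrow> if s = 0 then n - 1 else n)"
  by (induction n) (cases g; auto simp: next_state_funpow)+

text \<open>
  If \<open>p\<close> counts the letters consumed from each edge, \<open>produced N x p\<close> counts the letters put
  onto each edge. Once the network has halted, the two agree on all edges with a head.
\<close>

definition produced :: "('k, 'z) network_scheme \<Rightarrow> nat ^ 'k \<Rightarrow> (nat \<Rightarrow> nat) \<Rightarrow> nat \<Rightarrow> nat" where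
  "produced N x p e = fst (initial_config N x) e +
     (case tail_of N e of None \<Rightarrow> 0
      | Some v \<Rightarrow> gate_output (gate_at N v) (initial_state N v) (\<Sum>d\<in>in_edges N v. p d))"

text \<open>Fixed points of \<open>produced\<close>. Edges without a head are included, so there
  \<open>t\<close> counts the letters that come to rest.\<close>

definition flow :: "('k, 'z) network_scheme \<Rightarrow> nat ^ 'k \<Rightarrow> (nat \<Rightarrow> nat) \<Rightarrow> bool" where
  "flow N x t \<longleftrightarrow> (\<forall>e\<in>edges N. t e = produced N x t e)"

section \<open>Monotonicity and conservation of letters along runs\<close>

lemma produced_mono:
  assumes "\<And>e. e \<in> edges N \<Longrightarrow> p e \<le> q e"
  shows "produced N x p e \<le> produced N x q e"
proof -
  have "(\<Sum>d\<in>in_edges N v. p d) \<le> (\<Sum>d\<in>in_edges N v. q d)" for v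
    using assms by (intro sum_mono) (auto simp: in_edges_def)
  then show ?thesis
    by (auto simp: produced_def intro!: gate_output_mono split: option.split)
qed

text \<open>A configuration does not remember how many letters have been consumed; \<open>p\<close>
  is this ledger. The states belong to the invariant because they decide what the next letter
  emits.\<close>

definition consistent ::
    "('k, 'z) network_scheme \<Rightarrow> nat ^ 'k \<Rightarrow> config \<Rightarrow> (nat \<Rightarrow> nat) \<Rightarrow> bool" where
  "consistent N x c p \<longleftrightarrow>
     (\<forall>e\<in>edges N. fst c e + p e = produced N x p e \<and> (head_of N e = None \<longrightarrow> p e = 0)) \<and>
     (\<forall>v. snd c v =
        (next_state (gate_at N v) ^^ (\<Sum>d\<in>in_edges N v. p d)) (initial_state N v))"

lemma consistent_initial: "consistent N x (initial_config N x) (\<lambda>_. 0)"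
  by (auto simp: consistent_def produced_def initial_config_def split: option.split)

lemma consistent_step:
  assumes fin: "finite (edges N)"
    and "step N c c'" and con: "consistent N x c p"
  obtains e where "e \<in> edges N" "0 < fst c e" "consistent N x c' (p(e := Suc (p e)))"
  using assms(2)
proof (cases rule: step.cases)
  case (1 e v w s)
  let ?p = "p(e := Suc (p e))"
  \<comment> \<open>The edge \<open>e\<close> enters only its head \<open>v\<close>, so exactly one
    gate has received one letter more.\<close>
  have sum: "(\<Sum>d\<in>in_edges N u. ?p d) =
      (if u = v then Suc (\<Sum>d\<in>in_edges N u. p d) else (\<Sum>d\<in>in_edges N u. p d))" for u
  proof (cases "u = v")
    case True
    have "finite (in_edges N u)" "e \<in> in_edges N u"
      using fin 1 True by (auto simp: in_edges_def)
    then show ?thesis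
      using True by (simp add: sum.remove)
  next
    case False
    then have "e \<notin> in_edges N u"
      using 1 by (auto simp: in_edges_def)
    then show ?thesis
      using False by (auto intro: sum.cong)
  qed
  have st: "s u = (next_state (gate_at N u) ^^ (\<Sum>d\<in>in_edges N u. p d)) (initial_state N u)" for u
    using con 1 by (auto simp: consistent_def)
  \<comment> \<open>By the recursion of \<open>gate_output\<close>, one more letter adds exactly
    what the gate emits in its present state \<open>s v\<close>, known from
    \<open>st\<close>.\<close>
  have prod: "produced N x ?p d = produced N x p d +
      (if d \<in> out_edges N v then emits (gate_at N v) (s v) else 0)" if "d \<in> edges N" for d
    using that by (auto simp: produced_def sum st out_edges_def simp del: fun_upd_apply split: option.split)
  have "consistent N x c' ?p"
    unfolding consistent_def
  proof (intro conjI allI ballI impI)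
    fix d assume d: "d \<in> edges N"
    then have "w d + p d = produced N x p d"
      using con 1 by (auto simp: consistent_def)
    then show "fst c' d + ?p d = produced N x ?p d"
      using d 1 by (auto simp: prod)
    show "head_of N d = None \<Longrightarrow> ?p d = 0"
      using con d 1 by (auto simp: consistent_def)
  next
    fix u show "snd c' u =
      (next_state (gate_at N u) ^^ (\<Sum>d\<in>in_edges N u. ?p d)) (initial_state N u)"
      unfolding sum using 1 by (simp add: st)
  qed
  then show ?thesis
    using 1 that by auto
qed

lemma consistent_reachable:
  assumes "finite (edges N)" and "(step N)\<^sup>*\<^sup>* (initial_config N x) c"
  obtains p where "consistent N x c p"
proof -
  from assms(2) have "\<exists>p. consistent N x c p"
  proof (induction rule: rtranclp_induct)
    case base
    show ?case using consistent_initial by blast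
  next
    case (step c c')
    then show ?case using consistent_step[OF assms(1)] by metis
  qed
  then show ?thesis using that by blast
qed

text \<open>No letter waits on an edge with a head, so consumption equals production there. The flow
  is \<open>produced N x p\<close> and not \<open>p\<close>, which vanishes on edges without a
  head.\<close>

lemma halted_flow:
  assumes "abelian_network N" "(step N)\<^sup>*\<^sup>* (initial_config N x) c" "halted N c"
  obtains t where "flow N x t" "t (output_edge N) = fst c (output_edge N)"
proof -
  have fin: "finite (edges N)" and out: "output_edge N \<in> edges N" "head_of N (output_edge N) = None"
    using assms(1) by (auto simp: abelian_network_def)
  obtain p where p: "consistent N x c p"
    using consistent_reachable[OF fin assms(2)] .
  have zero: "fst c e = 0" if "e \<in> edges N" "head_of N e = Some v" for e v
    using assms(3) step.intros[OF that, of "fst c" "snd c"] by (auto simp: halted_def)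
  have eq: "produced N x p e = p e" if "e \<in> edges N" "head_of N e = Some v" for e v
    using p zero[OF that] that by (auto simp: consistent_def)
  \<comment> \<open>Every edge into a gate has a head, so \<open>p\<close> and
    \<open>produced N x p\<close> feed the gates alike.\<close>
  have "(\<Sum>d\<in>in_edges N v. produced N x p d) = (\<Sum>d\<in>in_edges N v. p d)" for v
    by (intro sum.cong) (auto simp: in_edges_def eq)
  then have "flow N x (produced N x p)"
    by (auto simp: flow_def) (auto simp: produced_def split: option.split)
  moreover have "produced N x p (output_edge N) = fst c (output_edge N)"
    using p out by (auto simp: consistent_def)
  ultimately show ?thesis using that by blast
qed

text \<open>Consumption never overtakes a flow: a waiting letter on \<open>e\<close> means that
  \<open>p e\<close> is below what has been produced, which by monotonicity is at most
  \<open>t e\<close>. As each step consumes one letter, the total flow bounds the length of a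
  run.\<close>

lemma flow_terminates:
  assumes fin: "finite (edges N)" and t: "flow N x t"
    and c0: "c 0 = initial_config N x" and steps: "\<And>n. step N (c n) (c (Suc n))"
  shows False
proof -
  have "\<exists>p. consistent N x (c n) p \<and> (\<forall>e\<in>edges N. p e \<le> t e) \<and> (\<Sum>e\<in>edges N. p e) = n" for n
  proof (induction n)
    case 0
    show ?case
      using consistent_initial[of N x] by (intro exI[of _ "\<lambda>_. 0"]) (auto simp: c0)
  next
    case (Suc n)
    then obtain p where p: "consistent N x (c n) p" "\<forall>e\<in>edges N. p e \<le> t e"
      "(\<Sum>e\<in>edges N. p e) = n" by blast
    obtain e where e: "e \<in> edges N" "0 < fst (c n) e"
      "consistent N x (c (Suc n)) (p(e := Suc (p e)))"
      using consistent_step[OF fin steps p(1)] .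
    have "fst (c n) e + p e = produced N x p e"
      using p(1) e by (auto simp: consistent_def)
    also have "\<dots> \<le> produced N x t e"
      using p(2) by (intro produced_mono) auto
    also have "\<dots> = t e"
      using t e by (auto simp: flow_def)
    finally have pe: "Suc (p e) \<le> t e"
      using e by simp
    have "(\<Sum>d\<in>edges N. (p(e := Suc (p e))) d) = Suc n"
      using p(3) fin e(1) by (simp add: sum.remove)
    moreover have "\<forall>d\<in>edges N. (p(e := Suc (p e))) d \<le> t d"
      using p(2) pe by simp
    ultimately show ?case
      using e(3) by blast
  qed
  from this[of "Suc (\<Sum>e\<in>edges N. t e)"] obtain p where
    "\<forall>e\<in>edges N. p e \<le> t e" "(\<Sum>e\<in>edges N. p e) = Suc (\<Sum>e\<in>edges N. t e)" by blast
  moreover from this(1) have "(\<Sum>e\<in>edges N. p e) \<le> (\<Sum>e\<in>edges N. t e)"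
    by (intro sum_mono) auto
  ultimately show False by simp
qed

section \<open>Uniqueness of flows, and flows versus computed functions\<close>

lemma acyclic_edge_induct:
  assumes "abelian_network N" "acyclic_network N" "e \<in> edges N"
    and step: "\<And>e. e \<in> edges N \<Longrightarrow>
      (\<And>v d. tail_of N e = Some v \<Longrightarrow> d \<in> in_edges N v \<Longrightarrow> P d) \<Longrightarrow> P e"
  shows "P e"
proof -
  let ?R = "{(u, v). \<exists>e\<in>edges N. tail_of N e = Some u \<and> head_of N e = Some v}"
  have "?R \<subseteq> nodes N \<times> nodes N" "finite (nodes N)"
    using assms(1) by (fastforce simp: abelian_network_def)+
  then have "finite ?R"
    by (meson finite_SigmaI finite_subset)
  then have wf: "wf ?R"
    using assms(2) by (auto simp: acyclic_network_def intro: finite_acyclic_wf)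
  \<comment> \<open>The induction runs over tails; for edges without a tail the induction hypothesis
    of \<open>step\<close> is vacuous.\<close>
  have "P d" if "d \<in> edges N" "tail_of N d = Some v" for v d
    using wf that
  proof (induction v arbitrary: d rule: wf_induct_rule)
    case (less v)
    have "P b" if b: "b \<in> in_edges N v" for b
    proof (cases "tail_of N b")
      case None
      then show ?thesis using b step[of b] by (auto simp: in_edges_def)
    next
      case (Some u)
      then show ?thesis using less.IH[of u b] b by (auto simp: in_edges_def)
    qed
    then show ?case using less.prems step[of d] by auto
  qed
  then show ?thesis
    using step[OF assms(3)] assms(3) by (cases "tail_of N e") auto
qed

lemma flow_unique:
  assumes "abelian_network N" "acyclic_network N" "e \<in> edges N"
    and t: "flow N x t" "flow N x t'"
  shows "t e = t' e"
  using assms(1-3)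
proof (rule acyclic_edge_induct)
  fix e assume e: "e \<in> edges N"
    and IH: "\<And>v d. tail_of N e = Some v \<Longrightarrow> d \<in> in_edges N v \<Longrightarrow> t d = t' d"
  have "produced N x t e = produced N x t' e"
    by (auto simp: produced_def IH split: option.split cong: sum.cong)
  then show "t e = t' e"
    using t e by (simp add: flow_def)
qed

text \<open>A flow bounds all runs, and its uniqueness fixes the result of each halted one; a
  network can thus be verified without looking at its runs.\<close>

lemma computes_if_flow:
  assumes N: "abelian_network N" "acyclic_network N"
    and t: "\<And>x. flow N x (t x)" "\<And>x. t x (output_edge N) = f x"
  shows "computes N f"
proof -
  have fin: "finite (edges N)" and out: "output_edge N \<in> edges N"
    using N by (auto simp: abelian_network_def)
  have "fst c (output_edge N) = f x"
    if c: "(step N)\<^sup>*\<^sup>* (initial_config N x) c" "halted N c" for x c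
  proof -
    obtain t' where t': "flow N x t'" "t' (output_edge N) = fst c (output_edge N)"
      using halted_flow[OF N(1) c] .
    show ?thesis
      using flow_unique[OF N out t'(1) t(1)] t'(2) t(2) by simp
  qed
  then show ?thesis
    unfolding computes_def using flow_terminates[OF fin t(1)] by blast
qed

text \<open>\<open>computes\<close> does not assert outright that a halted configuration is
  reachable. If none were, choosing a successor of each reachable configuration and iterating would
  give an infinite run.\<close>

lemma flow_if_computes:
  assumes N: "abelian_network N" and f: "computes N f"
  obtains t where "\<And>x. flow N x (t x)" "\<And>x. t x (output_edge N) = f x"
proof -
  have "\<exists>t. flow N x t \<and> t (output_edge N) = f x" for x
  proof -
    have "\<exists>c. (step N)\<^sup>*\<^sup>* (initial_config N x) c \<and> halted N c"
    proof (rule ccontr)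
      let ?R = "(step N)\<^sup>*\<^sup>* (initial_config N x)"
      assume "\<not> ?thesis"
      then have "\<exists>c'. ?R c \<longrightarrow> step N c c'" for c
        unfolding halted_def by blast
      then obtain g where g: "\<And>c. ?R c \<Longrightarrow> step N c (g c)"
        by metis
      have "?R ((g ^^ n) (initial_config N x))" for n
        by (induction n) (auto intro: g rtranclp.rtrancl_into_rtrancl)
      then have "step N ((g ^^ n) (initial_config N x)) ((g ^^ Suc n) (initial_config N x))" for n
        by (simp add: g)
      then have "\<exists>c. c 0 = initial_config N x \<and> (\<forall>n. step N (c n) (c (Suc n)))"
        by (intro exI[of _ "\<lambda>n. (g ^^ n) (initial_config N x)"]) auto
      then show False
        using f unfolding computes_def by blast
    qed
    then obtain c where c: "(step N)\<^sup>*\<^sup>* (initial_config N x) c" "halted N c" by blast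
    obtain t where "flow N x t" "t (output_edge N) = fst c (output_edge N)"
      using halted_flow[OF N c] .
    moreover have "fst c (output_edge N) = f x"
      using f c unfolding computes_def by blast
    ultimately show ?thesis by auto
  qed
  then show ?thesis using that by metis
qed

section \<open>The three conditions are necessary\<close>

lemma eventually_constant_binop:
  assumes "eventually_constant P" "eventually_constant Q"
  shows "eventually_constant (\<lambda>x. h (P x) (Q x))"
proof -
  obtain r s where "\<forall>x i. r $ i \<le> x $ i \<longrightarrow> P x = P (x + axis i 1)"
    "\<forall>x i. s $ i \<le> x $ i \<longrightarrow> Q x = Q (x + axis i 1)"
    using assms by (auto simp: eventually_constant_def)
  then show ?thesis
    unfolding eventually_constant_def
    by (intro exI[of _ "\<chi> i. max (r $ i) (s $ i)"]) auto
qed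

lemma nat_linear_zero: "nat_linear (\<lambda>_. 0)"
  unfolding nat_linear_def by (intro exI[of _ 0]) auto

lemma nat_linear_proj: "nat_linear (\<lambda>x. x $ i)"
  unfolding nat_linear_def
  by (intro exI[of _ "axis i 1"]) (auto simp: axis_def if_distrib[of "\<lambda>b. b * _"] cong: if_cong)

lemma nat_linear_add: "nat_linear L \<Longrightarrow> nat_linear M \<Longrightarrow> nat_linear (\<lambda>x. L x + M x)"
  unfolding nat_linear_def
proof (elim exE)
  fix b c assume "\<forall>x. L x = (\<Sum>i\<in>UNIV. b $ i * x $ i)" "\<forall>x. M x = (\<Sum>i\<in>UNIV. c $ i * x $ i)"
  then show "\<exists>b. \<forall>x. L x + M x = (\<Sum>i\<in>UNIV. b $ i * x $ i)"
    by (intro exI[of _ "b + c"]) (auto simp: algebra_simps sum.distrib)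
qed

section \<open>Closure of the three conditions under the gate operations\<close>

definition linear_plus_constant :: "(nat ^ 'k \<Rightarrow> nat) \<Rightarrow> bool" where
  "linear_plus_constant f \<longleftrightarrow> f 0 = 0 \<and> mono f \<and>
     (\<exists>L P. nat_linear L \<and> eventually_constant P \<and> (\<forall>x. of_nat (f x) = of_nat (L x) + P x))"

text \<open>Beyond the threshold \<open>P\<close> cancels from the difference of the two values,
  which leaves the increment of \<open>L\<close>. This form avoids rational numbers.\<close>

lemma linear_plus_constantE:
  assumes "linear_plus_constant f"
  obtains b r where "f 0 = 0" "mono f" "\<And>x i. r $ i \<le> x $ i \<Longrightarrow> f (x + axis i 1) = f x + b $ i"
proof -
  from assms obtain L P where f: "f 0 = 0" "mono f" and LP: "nat_linear L" "eventually_constant P"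
    "\<And>x. of_nat (f x) = of_nat (L x) + P x"
    by (auto simp: linear_plus_constant_def)
  obtain b where b: "\<And>x. L x = (\<Sum>i\<in>UNIV. b $ i * x $ i)"
    using LP(1) by (auto simp: nat_linear_def)
  obtain r where r: "\<And>x i. r $ i \<le> x $ i \<Longrightarrow> P x = P (x + axis i 1)"
    using LP(2) by (auto simp: eventually_constant_def)
  have L: "L (x + axis i 1) = L x + b $ i" for x i
    by (auto simp: b algebra_simps sum.distrib axis_def if_distrib[of "\<lambda>z. _ * z"] cong: if_cong)
  have "f (x + axis i 1) = f x + b $ i" if "r $ i \<le> x $ i" for x i
  proof -
    have "(of_nat (f (x + axis i 1)) :: rat) = of_nat (f x + b $ i)"
      using r[OF that] by (simp add: LP(3) L del: One_nat_def)
    then show ?thesis by (simp only: of_nat_eq_iff)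
  qed
  then show ?thesis using f that by blast
qed

lemma linear_plus_constant_zero: "linear_plus_constant (\<lambda>_. 0)"
  unfolding linear_plus_constant_def
  by (intro conjI exI[of _ "\<lambda>_. 0"]) (auto simp: nat_linear_zero eventually_constant_def mono_def)

lemma linear_plus_constant_proj: "linear_plus_constant (\<lambda>x. x $ i)"
  unfolding linear_plus_constant_def
  by (intro conjI exI[of _ "\<lambda>x. x $ i"] exI[of _ "\<lambda>_. 0"])
    (auto simp: nat_linear_proj eventually_constant_def mono_def less_eq_vec_def)

lemma linear_plus_constant_add:
  assumes "linear_plus_constant f" "linear_plus_constant g"
  shows "linear_plus_constant (\<lambda>x. f x + g x)"
proof -
  obtain L P M Q where *: "nat_linear L" "eventually_constant P" "nat_linear M" "eventually_constant Q"
    "\<And>x. of_nat (f x) = of_nat (L x) + P x" "\<And>x. of_nat (g x) = of_nat (M x) + Q x"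
    "f 0 = 0" "mono f" "g 0 = 0" "mono g"
    using assms by (auto simp: linear_plus_constant_def)
  then show ?thesis
    unfolding linear_plus_constant_def
    by (intro conjI exI[of _ "\<lambda>x. L x + M x"] exI[of _ "\<lambda>x. P x + Q x"])
      (auto simp: nat_linear_add eventually_constant_binop mono_def add_mono)
qed

lemma linear_plus_constant_sum:
  "(\<And>d. d \<in> A \<Longrightarrow> linear_plus_constant (g d)) \<Longrightarrow> linear_plus_constant (\<lambda>x. \<Sum>d\<in>A. g d x)"
  by (induction A rule: infinite_finite_induct)
    (auto simp: linear_plus_constant_zero linear_plus_constant_add)

text \<open>
  If \<open>f x = 0\<close> with \<open>x i\<close> beyond the threshold, then the slope \<open>b i\<close> must vanish, because
  \<open>f x\<close> is the sum of \<open>b i\<close> and an earlier value.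
\<close>

lemma eventually_constant_min_1:
  assumes "linear_plus_constant f"
  shows "eventually_constant (\<lambda>x. of_nat (min (f x) 1))"
proof -
  obtain b r where "f 0 = 0" "mono f" and br: "\<And>x i. r $ i \<le> x $ i \<Longrightarrow> f (x + axis i 1) = f x + b $ i"
    by (rule linear_plus_constantE[OF assms]) blast
  have "min (f x) 1 = min (f (x + axis i 1)) 1" if "Suc (r $ i) \<le> x $ i" for x i
  proof -
    \<comment> \<open>One step back from \<open>x\<close> in direction \<open>i\<close>. The
      threshold \<open>Suc (r $ i)\<close> keeps \<open>y\<close> within reach of \<open>br\<close>,
      so \<open>f x = f y + b $ i\<close>.\<close>
    define y where "y = (\<chi> j. x $ j - axis i 1 $ j)"
    have "x = y + axis i 1" "r $ i \<le> y $ i"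
      using that by (auto simp: y_def vec_eq_iff axis_def)
    then show ?thesis
      using br[of i x] br[of i y] that by auto
  qed
  then show ?thesis
    unfolding eventually_constant_def
    by (intro exI[of _ "\<chi> i. Suc (r $ i)"]) auto
qed

text \<open>The capped function is itself eventually constant, so its linear part is 0.\<close>

lemma linear_plus_constant_min_1:
  assumes "linear_plus_constant f"
  shows "linear_plus_constant (\<lambda>x. min (f x) 1)"
proof -
  have "f 0 = 0" "mono f"
    using assms by (auto simp: linear_plus_constant_def)
  moreover have "mono (\<lambda>x. min (f x) 1)"
    using \<open>mono f\<close> unfolding mono_def by (metis min.mono order_refl)
  ultimately show ?thesis
    unfolding linear_plus_constant_def using eventually_constant_min_1[OF assms]
    by (intro conjI exI[of _ "\<lambda>_. 0"] exI[of _ "\<lambda>x. of_nat (min (f x) 1)"])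
      (auto simp: nat_linear_zero)
qed

text \<open>Since \<open>f x - 1 = f x - min (f x) 1\<close>, only the eventually constant part
  changes.\<close>

lemma linear_plus_constant_minus_1:
  assumes "linear_plus_constant f"
  shows "linear_plus_constant (\<lambda>x. f x - 1)"
proof -
  obtain L P where *: "nat_linear L" "eventually_constant P"
    "\<And>x. of_nat (f x) = of_nat (L x) + P x" "f 0 = 0" "mono f"
    using assms by (auto simp: linear_plus_constant_def)
  have "eventually_constant (\<lambda>x. P x - of_nat (min (f x) 1))"
    using *(2) eventually_constant_min_1[OF assms] by (rule eventually_constant_binop)
  moreover have "of_nat (f x - 1) = of_nat (L x) + (P x - of_nat (min (f x) 1))" for x
  proof -
    have "of_nat (f x - 1) + of_nat (min (f x) 1) = (of_nat (f x) :: rat)"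
      by (simp flip: of_nat_add add: min_def)
    then show ?thesis by (simp add: *(3))
  qed
  moreover have "mono (\<lambda>x. f x - 1)"
    using *(5) by (auto simp: mono_def diff_le_mono)
  ultimately show ?thesis
    unfolding linear_plus_constant_def using *(1,4)
    by (intro conjI exI[of _ L] exI[of _ "\<lambda>x. P x - of_nat (min (f x) 1)"]) auto
qed

lemma linear_plus_constant_gate_output:
  assumes "linear_plus_constant f" "s \<in> states g"
  shows "linear_plus_constant (\<lambda>x. gate_output g s (f x))"
  using assms linear_plus_constant_min_1[OF assms(1)] linear_plus_constant_minus_1[OF assms(1)]
    linear_plus_constant_zero
  by (cases g) (auto simp: gate_output_eq)

text \<open>By induction along the edges, each carries an admissible function: an input edge carries
  a coordinate, any other edge the output of a gate fed with a sum of admissible functions.\<close>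

lemma linear_plus_constant_if_computes:
  assumes N: "abelian_network N" "acyclic_network N" and f: "computes N f"
  shows "linear_plus_constant f"
proof -
  obtain t where t: "\<And>x. flow N x (t x)" "\<And>x. t x (output_edge N) = f x"
    by (rule flow_if_computes[OF N(1) f]) blast
  have ab: "inj (input_edge N)" "range (input_edge N) = {e \<in> edges N. tail_of N e = None}"
    "output_edge N \<in> edges N"
    "\<And>e v. e \<in> edges N \<Longrightarrow> tail_of N e = Some v \<Longrightarrow> v \<in> nodes N"
    "\<And>v. v \<in> nodes N \<Longrightarrow> initial_state N v \<in> states (gate_at N v)"
    using N(1) by (auto simp: abelian_network_def)
  have "linear_plus_constant (\<lambda>x. t x e)" if "e \<in> edges N" for e
    using N that
  proof (rule acyclic_edge_induct)
    fix e assume e: "e \<in> edges N"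
      and IH: "\<And>v d. tail_of N e = Some v \<Longrightarrow> d \<in> in_edges N v \<Longrightarrow> linear_plus_constant (\<lambda>x. t x d)"
    have te: "t x e = produced N x (t x) e" for x
      using t(1) e by (auto simp: flow_def)
    show "linear_plus_constant (\<lambda>x. t x e)"
    proof (cases "tail_of N e")
      case None
      then obtain i where i: "e = input_edge N i"
        using ab(2) e by blast
      have "{j. input_edge N j = e} = {i}"
        using ab(1) by (auto simp: i dest: injD)
      then have "t x e = x $ i" for x
        by (simp add: te None produced_def initial_config_def)
      then show ?thesis by (simp add: linear_plus_constant_proj)
    next
      case (Some v)
      then have "e \<notin> range (input_edge N)"
        unfolding ab(2) by simp
      then have "{j. input_edge N j = e} = {}"
        by auto
      then have "t x e = gate_output (gate_at N v) (initial_state N v) (\<Sum>d\<in>in_edges N v. t x d)" for x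
        by (simp add: te Some produced_def initial_config_def)
      then show ?thesis
        using IH[OF Some] ab(5)[OF ab(4)[OF e Some]]
        by (simp add: linear_plus_constant_gate_output linear_plus_constant_sum)
    qed
  qed
  from this[OF ab(3)] show ?thesis by (simp add: t(2))
qed

section \<open>Functions generated by the gates\<close>

text \<open>The splitter needs no clause, as a function may be used any number of times;
  \<open>zero\<close> is a presink started in state 1.\<close>

inductive gate_function :: "(nat ^ 'k \<Rightarrow> nat) \<Rightarrow> bool" where
  proj: "gate_function (\<lambda>x. x $ i)"
| zero: "gate_function (\<lambda>_. 0)"
| add: "gate_function f \<Longrightarrow> gate_function g \<Longrightarrow> gate_function (\<lambda>x. f x + g x)"
| min_1: "gate_function f \<Longrightarrow> gate_function (\<lambda>x. min (f x) 1)"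
| minus_1: "gate_function f \<Longrightarrow> gate_function (\<lambda>x. f x - 1)"

lemma gate_function_sum:
  "(\<And>a. a \<in> A \<Longrightarrow> gate_function (g a)) \<Longrightarrow> gate_function (\<lambda>x. \<Sum>a\<in>A. g a x)"
  by (induction A rule: infinite_finite_induct) (auto intro: gate_function.intros)

lemma gate_function_mult: "gate_function f \<Longrightarrow> gate_function (\<lambda>x. n * f x)"
  by (induction n) (auto intro: gate_function.intros)

lemma gate_function_minus: "gate_function f \<Longrightarrow> gate_function (\<lambda>x. f x - n)"
proof (induction n)
  case (Suc n)
  then have "gate_function (\<lambda>x. f x - n - 1)"
    by (intro minus_1) auto
  then show ?case by simp
qed auto

section \<open>Indicators of up-sets\<close>

lemma gate_function_threshold:
  assumes "m \<noteq> 0" "gate_function f"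
  shows "gate_function (\<lambda>x. of_bool (m \<le> f x))"
proof -
  \<comment> \<open>Subtracting \<open>m - 1\<close> leaves a positive number exactly if the
    threshold is reached. For \<open>m = 0\<close> the indicator would be constantly 1, whereas
    generated functions vanish at the origin.\<close>
  have "of_bool (m \<le> f x) = min (f x - (m - 1)) 1" for x
    using assms by auto
  then show ?thesis
    using gate_function_minus[OF assms(2)] by (simp only: min_1)
qed

lemma gate_function_conj:
  assumes "gate_function (\<lambda>x. of_bool (p x))" "gate_function (\<lambda>x. of_bool (q x))"
  shows "gate_function (\<lambda>x. of_bool (p x \<and> q x))"
proof -
  have "of_bool (p x \<and> q x) = of_bool (p x) + of_bool (q x) - (1::nat)" for x
    by auto
  then show ?thesis
    using assms by (simp only: minus_1 add)
qed

text \<open>\<open>A\<close> is nonempty because an empty conjunction is the constant 1, which is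
  not generated.\<close>

lemma gate_function_Ball:
  assumes "finite A" "A \<noteq> {}" "\<And>a. a \<in> A \<Longrightarrow> gate_function (\<lambda>x. of_bool (p a x))"
  shows "gate_function (\<lambda>x. of_bool (\<forall>a\<in>A. p a x))"
  using assms
  by (induction A rule: finite_ne_induct) (auto intro: gate_function_conj)

lemma gate_function_Bex:
  assumes "finite A" "\<And>a. a \<in> A \<Longrightarrow> gate_function (\<lambda>x. of_bool (p a x))"
  shows "gate_function (\<lambda>x. of_bool (\<exists>a\<in>A. p a x))"
proof -
  have "of_bool (\<exists>a\<in>A. p a x) = min (\<Sum>a\<in>A. of_bool (p a x)) (1::nat)" for x
  proof (cases "\<exists>a\<in>A. p a x")
    case True
    then have "(\<Sum>a\<in>A. of_bool (p a x)) \<noteq> (0::nat)"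
      using assms(1) by (auto simp: sum_eq_0_iff)
    then show ?thesis using True by (simp add: min_def)
  qed auto
  then show ?thesis
    using assms by (simp only: min_1 gate_function_sum)
qed

text \<open>Coordinates where \<open>m\<close> is 0 impose no condition. The others give thresholds
  that are not 0, and \<open>m \<noteq> 0\<close> leaves at least one of them.\<close>

lemma gate_function_atLeast:
  fixes m :: "nat ^ 'k"
  assumes "m \<noteq> 0"
  shows "gate_function (\<lambda>x. of_bool (m \<le> x))"
proof -
  let ?A = "{i. m $ i \<noteq> 0}"
  have "gate_function (\<lambda>x :: nat ^ 'k. of_bool (\<forall>i\<in>?A. m $ i \<le> x $ i))"
    using assms
    by (intro gate_function_Ball gate_function_threshold proj) (auto simp: vec_eq_iff)
  moreover have "m \<le> x \<longleftrightarrow> (\<forall>i\<in>?A. m $ i \<le> x $ i)" for x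
    by (auto simp: less_eq_vec_def) (metis le0 gr0I)
  ultimately show ?thesis by simp
qed

section \<open>Truncation to a box and linear growth outside it\<close>

lemma finite_atMost_nat_vec: "finite {..r :: nat ^ 'k}"
proof (rule finite_imageD)
  \<comment> \<open>The vacuous clause outside \<open>UNIV\<close> gives the bounding set the shape
    that \<open>finite_set_of_finite_funs\<close> expects.\<close>
  have "(\<lambda>x. ($) x) ` {..r} \<subseteq> {g. \<forall>i. (i \<in> UNIV \<longrightarrow> g i \<in> {..Max (range (($) r))}) \<and> (i \<notin> UNIV \<longrightarrow> g i = 0)}"
    by (auto simp: less_eq_vec_def) (meson Max_ge UNIV_I finite finite_imageI image_eqI order_trans)
  then show "finite ((\<lambda>x. ($) x) ` {..r})"
    by (rule finite_subset) (intro finite_set_of_finite_funs; simp)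
qed (auto simp: inj_on_def vec_eq_iff)

text \<open>A number is the count of the levels \<open>n\<close> from 1 up to it. By monotonicity
  each level set is an up-set, the union of the cones above its finitely many points in the
  box.\<close>

lemma gate_function_truncated:
  fixes f :: "nat ^ 'k \<Rightarrow> nat"
  assumes "f 0 = 0" "mono f"
  shows "gate_function (\<lambda>x. f (\<chi> i. min (x $ i) (r $ i)))"
proof -
  let ?c = "\<lambda>x. \<chi> i. min (x $ i) (r $ i)"
  \<comment> \<open>Levels start at 1, so \<open>f 0 = 0\<close> excludes \<open>m = 0\<close>, as
    \<open>gate_function_atLeast\<close> requires.\<close>
  have "gate_function (\<lambda>x. \<Sum>n\<in>{1..f r}. of_bool (\<exists>m\<in>{m. m \<le> r \<and> n \<le> f m}. m \<le> x))"
  proof (intro gate_function_sum gate_function_Bex gate_function_atLeast)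
    show "finite {m. m \<le> r \<and> n \<le> f m}" for n
      using finite_atMost_nat_vec[of r] by (rule finite_subset[rotated]) auto
  qed (use assms in auto)
  moreover have "f (?c x) = (\<Sum>n\<in>{1..f r}. of_bool (\<exists>m\<in>{m. m \<le> r \<and> n \<le> f m}. m \<le> x))" for x
  proof -
    \<comment> \<open>The truncated point is above every such \<open>m\<close>, and is itself the
      witness for the converse.\<close>
    have "(\<exists>m\<in>{m. m \<le> r \<and> n \<le> f m}. m \<le> x) \<longleftrightarrow> n \<le> f (?c x)" for n
    proof
      assume "\<exists>m\<in>{m. m \<le> r \<and> n \<le> f m}. m \<le> x"
      then obtain m where "m \<le> r" "m \<le> x" "n \<le> f m" by auto
      moreover from this have "m \<le> ?c x" by (auto simp: less_eq_vec_def)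
      ultimately show "n \<le> f (?c x)"
        using \<open>mono f\<close> by (meson monoD order_trans)
    qed (auto simp: less_eq_vec_def intro!: exI[of _ "?c x"])
    moreover have "f (?c x) \<le> f r"
      using \<open>mono f\<close> by (rule monoD) (auto simp: less_eq_vec_def)
    then have "{1..f r} \<inter> {n. n \<le> f (?c x)} = {1..f (?c x)}" by auto
    ultimately show ?thesis
      by (simp add: of_bool_def sum.If_cases)
  qed
  ultimately show ?thesis by simp
qed

text \<open>By induction on the total excess of \<open>x\<close> over \<open>r\<close>: removing one
  unit of excess in direction \<open>i\<close> lowers \<open>f\<close> by \<open>b $ i\<close> and
  leaves the truncated point unchanged.\<close>

lemma truncation_eq:
  fixes f :: "nat ^ 'k \<Rightarrow> nat"
  assumes "\<And>x i. r $ i \<le> x $ i \<Longrightarrow> f (x + axis i 1) = f x + b $ i"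
  shows "f x = (\<Sum>i\<in>UNIV. b $ i * (x $ i - r $ i)) + f (\<chi> i. min (x $ i) (r $ i))"
proof (induction "\<Sum>i\<in>UNIV. x $ i - r $ i" arbitrary: x)
  case 0
  then have "x $ i \<le> r $ i" for i by (simp add: sum_eq_0_iff)
  then have "(\<chi> i. min (x $ i) (r $ i)) = x" by (simp add: vec_eq_iff)
  then show ?case using 0 by simp
next
  case (Suc n)
  have "\<exists>i. r $ i < x $ i"
  proof (rule ccontr)
    assume "\<not> ?thesis"
    then have "x $ i - r $ i = 0" for i by (simp add: not_less)
    then show False using Suc(2) by simp
  qed
  then obtain i where i: "r $ i < x $ i" ..
  define y where "y = (\<chi> j. x $ j - axis i 1 $ j)"
  have x: "x = y + axis i 1" and ri: "r $ i \<le> y $ i"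
    using i by (auto simp: y_def vec_eq_iff axis_def)
  have diff: "x $ j - r $ j = (y $ j - r $ j) + of_bool (j = i)" for j
    using ri by (auto simp: x axis_def)
  have "(\<chi> j. min (x $ j) (r $ j)) = (\<chi> j. min (y $ j) (r $ j))"
    using ri by (auto simp: x axis_def vec_eq_iff)
  moreover have "(\<Sum>j\<in>UNIV. b $ j * (x $ j - r $ j)) = (\<Sum>j\<in>UNIV. b $ j * (y $ j - r $ j)) + b $ i"
    by (simp add: diff algebra_simps sum.distrib)
  moreover have "n = (\<Sum>j\<in>UNIV. y $ j - r $ j)"
    using Suc(2) by (simp add: diff sum.distrib)
  ultimately show ?case
    using Suc(1)[of y] assms[OF ri] x by simp
qed

lemma gate_function_if_linear_plus_constant:
  assumes "linear_plus_constant f"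
  shows "gate_function f"
proof -
  obtain b r where f: "f 0 = 0" "mono f"
    and br: "\<And>x i. r $ i \<le> x $ i \<Longrightarrow> f (x + axis i 1) = f x + b $ i"
    by (rule linear_plus_constantE[OF assms]) blast
  have "gate_function (\<lambda>x. (\<Sum>i\<in>UNIV. b $ i * (x $ i - r $ i)) + f (\<chi> i. min (x $ i) (r $ i)))"
    using gate_function_truncated[OF f]
    by (rule add[rotated]) (intro gate_function_sum gate_function_mult gate_function_minus proj)
  then show ?thesis
    by (simp only: truncation_eq[OF br, symmetric])
qed

section \<open>Networks for the generated functions\<close>

text \<open>
  A multiset, because using a member as the input of a gate consumes it; a splitter is needed
  to have it twice.
\<close>

definition available :: "(nat ^ 'k \<Rightarrow> nat) multiset \<Rightarrow> bool" where
  "available A \<longleftrightarrow> (\<exists>(N :: 'k network) t D. abelian_network N \<and> acyclic_network N \<and>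
     (\<forall>x. flow N x (t x)) \<and> D \<subseteq> {e \<in> edges N. head_of N e = None} \<and>
     image_mset (\<lambda>e x. t x e) (mset_set D) = A)"

section \<open>The base network: one identity wire per input\<close>

lemma available_proj: "available (image_mset (\<lambda>i x. x $ i) (mset_set (UNIV :: ('k :: finite) set)))"
proof -
  let ?n = "CARD('k)"
  obtain c :: "'k \<Rightarrow> nat" where c: "bij_betw c UNIV {..<?n}"
    using finite_same_card_bij[of "UNIV :: 'k set" "{..<?n}"] by auto
  then have inj: "inj c" and range: "range c = {..<?n}"
    by (auto simp: bij_betw_def)
  have inv: "inv c (c i) = i" "c (inv c m) = m" if "m < ?n" for i m
    using inj range that by (auto intro: f_inv_into_f)
  \<comment> \<open>No edge may dangle at both ends, so each input passes through a delayer in state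
    1. Edge \<open>2 * m\<close> enters node \<open>m\<close> and edge \<open>2 * m + 1\<close>
    leaves it.\<close>
  define N :: "'k network" where "N = \<lparr>nodes = {..<?n}, edges = {..<2 * ?n},
    tail_of = (\<lambda>e. if even e then None else Some (e div 2)),
    head_of = (\<lambda>e. if even e then Some (e div 2) else None),
    gate_at = (\<lambda>_. Delayer), initial_state = (\<lambda>_. 1),
    input_edge = (\<lambda>i. 2 * c i), output_edge = 1\<rparr>"
  define t where "t = (\<lambda>x :: nat ^ 'k. \<lambda>e. x $ inv c (e div 2))"
  have in_edges: "in_edges N v = {2 * v}" and out_edges: "out_edges N v = {Suc (2 * v)}"
    if "v < ?n" for v
    using that by (auto simp: in_edges_def out_edges_def N_def)
  have "range (input_edge N) = {e \<in> edges N. tail_of N e = None}"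
  proof -
    have "range (input_edge N) = (\<lambda>m. 2 * m) ` range c"
      by (auto simp: N_def)
    also have "\<dots> = {e \<in> edges N. tail_of N e = None}"
      unfolding range by (auto simp: N_def elim!: evenE)
    finally show ?thesis .
  qed
  moreover have "inj (input_edge N)"
    using inj by (auto simp: N_def inj_def)
  \<comment> \<open>Edge 1, the provisional output edge, exists because there is at least one
    index.\<close>
  moreover have "1 < 2 * ?n"
    using zero_less_card_finite[where 'a = 'k] by linarith
  ultimately have "abelian_network N"
    using in_edges out_edges by (auto simp: abelian_network_def N_def)
  moreover have "acyclic_network N"
  proof -
    have "{(u, v). \<exists>e\<in>edges N. tail_of N e = Some u \<and> head_of N e = Some v} = {}"
      by (auto simp: N_def)
    then show ?thesis unfolding acyclic_network_def by (simp only: acyclic_def trancl_empty empty_iff) simp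
  qed
  moreover have "flow N x (t x)" for x
    unfolding flow_def
  proof
    fix e assume e: "e \<in> edges N"
    show "t x e = produced N x (t x) e"
    proof (cases "even e")
      case True
      then obtain m where m: "e = 2 * m" by (elim evenE)
      then have "m < ?n" using e by (simp add: N_def)
      then have "{i. 2 * c i = e} = {inv c m}"
        using inv by (auto simp: m)
      then show ?thesis
        using m by (simp add: produced_def initial_config_def t_def N_def)
    next
      case False
      then obtain m where m: "e = Suc (2 * m)" by (elim oddE) simp
      then have "m < ?n" using e by (simp add: N_def)
      then have "produced N x (t x) e = t x (2 * m)"
        using m in_edges[of m] double_not_eq_Suc_double
        by (simp add: produced_def initial_config_def N_def gate_output_eq)
      then show ?thesis by (simp add: t_def m)
    qed
  qed
  moreover have "image_mset (\<lambda>e x. t x e) (mset_set ((\<lambda>i. Suc (2 * c i)) ` UNIV)) =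
      image_mset (\<lambda>i x. x $ i) (mset_set UNIV)"
  proof -
    have "inj (\<lambda>i. Suc (2 * c i))"
      using inj by (auto simp: inj_def)
    then have "mset_set ((\<lambda>i. Suc (2 * c i)) ` UNIV) = image_mset (\<lambda>i. Suc (2 * c i)) (mset_set UNIV)"
      by (simp add: image_mset_mset_set)
    then show ?thesis
      using inj by (simp add: t_def multiset.map_comp comp_def)
  qed
  moreover have "(\<lambda>i. Suc (2 * c i)) ` UNIV \<subseteq> {e \<in> edges N. head_of N e = None}"
  proof -
    have "c i < ?n" for i using range by auto
    then have "Suc (2 * c i) < 2 * ?n" for i
      using Suc_leI[of "c i" ?n] by simp
    then show ?thesis by (auto simp: N_def)
  qed
  ultimately show ?thesis
    unfolding available_def by blast
qed

text \<open>A new gate is attached to the dangling edges that carry \<open>B\<close>, and fresh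
  dangling edges leave it. The old flow extends to them by the output of the gate.\<close>

lemma available_gate:
  fixes A B :: "(nat ^ 'k \<Rightarrow> nat) multiset"
  assumes "available (B + A)" and size: "size B = num_inputs g" and s: "s \<in> states g"
  shows "available (replicate_mset (num_outputs g) (\<lambda>x. gate_output g s (\<Sum>h\<in>#B. h x)) + A)"
proof -
  obtain N :: "'k network" and t D where N: "abelian_network N" "acyclic_network N"
    and t: "\<And>x. flow N x (t x)" and D: "D \<subseteq> {e \<in> edges N. head_of N e = None}"
    and BA: "image_mset (\<lambda>e x. t x e) (mset_set D) = B + A"
    using assms(1) by (auto simp: available_def)
  have fin: "finite (nodes N)" "finite (edges N)"
    and ends: "\<And>e. e \<in> edges N \<Longrightarrow> set_option (tail_of N e) \<subseteq> nodes N \<and> set_option (head_of N e) \<subseteq> nodes N"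
    and inputs: "range (input_edge N) = {e \<in> edges N. tail_of N e = None}"
    using N(1) by (simp_all add: abelian_network_def)
  have finD: "finite D"
    using D fin by (auto intro: finite_subset)
  obtain B' A' where split: "mset_set D = B' + A'" "image_mset (\<lambda>e x. t x e) B' = B"
    "image_mset (\<lambda>e x. t x e) A' = A"
    using image_mset_eq_plusD[OF BA] by metis
  define I where "I = set_mset B'"
  have ID: "I \<subseteq> D"
    using split(1) finD unfolding I_def by (metis elem_mset_set set_mset_mono mset_subset_eq_add_left subsetI subsetD)
  then have finI: "finite I" using finD by (rule finite_subset)
  have B': "B' = mset_set I"
  proof (rule multiset_eqI)
    fix d
    \<comment> \<open>\<open>B'\<close> is part of the multiset of a set, so it consists of distinct
      edges.\<close>
    have "count B' d \<le> 1"
      using arg_cong[OF split(1), of "\<lambda>M. count M d"] by (simp add: count_mset_set' split: if_splits)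
    then show "count B' d = count (mset_set I) d"
      by (auto simp: I_def count_mset_set' le_Suc_eq count_eq_zero_iff)
  qed
  then have A': "A' = mset_set (D - I)"
    using split(1) finD ID by (simp add: mset_set_Diff)
  have cardI: "card I = num_inputs g"
    using size split(2) B' by auto
  obtain v where v: "v \<notin> nodes N"
    using fin(1) by (meson ex_new_if_finite infinite_UNIV_nat)
  obtain Out where Out: "finite Out" "card Out = num_outputs g" "Out \<inter> edges N = {}"
    using infinite_arbitrarily_large[of "- edges N" "num_outputs g"] fin(2) by auto
  \<comment> \<open>Every gate has an output, so some fresh edge can be the provisional output
    edge.\<close>
  then obtain o1 where o1: "o1 \<in> Out"
    by (cases g; fastforce)
  define N' :: "'k network" where "N' = \<lparr>nodes = insert v (nodes N), edges = edges N \<union> Out,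
    tail_of = (\<lambda>e. if e \<in> Out then Some v else tail_of N e),
    head_of = (\<lambda>e. if e \<in> Out then None else if e \<in> I then Some v else head_of N e),
    gate_at = (gate_at N)(v := g), initial_state = (initial_state N)(v := s),
    input_edge = input_edge N, output_edge = o1\<rparr>"
  define t' where "t' = (\<lambda>x e. if e \<in> Out then gate_output g s (\<Sum>d\<in>I. t x d) else t x e)"
  have Iedges: "I \<subseteq> edges N" "\<And>e. e \<in> I \<Longrightarrow> head_of N e = None" "I \<inter> Out = {}"
    using ID D Out(3) by auto
  have fresh: "tail_of N e \<noteq> Some v" "head_of N e \<noteq> Some v" if "e \<in> edges N" for e
    using ends[OF that] v by auto
  have in_v: "in_edges N' v = I"
    using Iedges fresh(2) by (auto simp: in_edges_def N'_def)
  have out_v: "out_edges N' v = Out"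
    using fresh(1) by (auto simp: out_edges_def N'_def)
  have in_u: "in_edges N' u = in_edges N u" if "u \<noteq> v" for u
    using that Iedges(2) Out(3) by (auto simp: in_edges_def N'_def split: if_splits)
  have out_u: "out_edges N' u = out_edges N u" if "u \<noteq> v" for u
    using that Out(3) by (auto simp: out_edges_def N'_def split: if_splits)
  have "abelian_network N'"
    unfolding abelian_network_def
  proof (intro conjI ballI)
    show "finite (nodes N')" "finite (edges N')"
      using fin Out(1) by (auto simp: N'_def)
    show "set_option (tail_of N' e) \<subseteq> nodes N'" "set_option (head_of N' e) \<subseteq> nodes N'"
      if "e \<in> edges N'" for e
      using that ends[of e] by (auto simp: N'_def)
    show "tail_of N' e \<noteq> None \<or> head_of N' e \<noteq> None" if "e \<in> edges N'" for e
      using that N(1) by (auto simp: N'_def abelian_network_def)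
    show "inj (input_edge N')"
      using N(1) by (simp add: N'_def abelian_network_def)
    show "range (input_edge N') = {e \<in> edges N'. tail_of N' e = None}"
      using inputs Out(3) by (auto simp: N'_def)
    show "output_edge N' \<in> edges N'" "head_of N' (output_edge N') = None"
      using o1 by (auto simp: N'_def)
  next
    fix u assume u: "u \<in> nodes N'"
    show "card (in_edges N' u) = num_inputs (gate_at N' u)"
      "card (out_edges N' u) = num_outputs (gate_at N' u)"
      "initial_state N' u \<in> states (gate_at N' u)"
      using u N(1) cardI Out(2) s
      by (cases "u = v"; simp add: in_v out_v in_u out_u; simp add: N'_def abelian_network_def)+
  qed
  moreover have "acyclic_network N'"
  proof -
    let ?R = "{(u, w). \<exists>e\<in>edges N. tail_of N e = Some u \<and> head_of N e = Some w}"
    let ?R' = "{(u, w). \<exists>e\<in>edges N'. tail_of N' e = Some u \<and> head_of N' e = Some w}"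
    have "?R' \<subseteq> ?R \<union> nodes N \<times> {v}"
    proof
      fix p assume "p \<in> ?R'"
      then obtain u w e where p: "p = (u, w)"
        and e: "e \<in> edges N'" "tail_of N' e = Some u" "head_of N' e = Some w"
        by blast
      from e(3) have "e \<notin> Out" by (auto simp: N'_def)
      with e have eN: "e \<in> edges N" "tail_of N e = Some u" "w = v \<or> head_of N e = Some w"
        by (auto simp: N'_def split: if_splits)
      then have "u \<in> nodes N" using ends[of e] by simp
      then show "p \<in> ?R \<union> nodes N \<times> {v}"
        using p eN by blast
    qed
    moreover have "acyclic (?R \<union> nodes N \<times> {v})"
    proof -
      have "?R \<subseteq> nodes N \<times> nodes N"
        using ends by (force simp: subset_iff)
      have "wf ?R"
        using N(2) finite_subset[OF \<open>?R \<subseteq> _\<close>] fin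
        by (auto simp: acyclic_network_def intro!: finite_acyclic_wf)
      moreover have "wf (nodes N \<times> {v})"
        using v by (intro wfI_min) (metis SigmaD1 SigmaD2 singletonD)
      \<comment> \<open>No old arrow starts at \<open>v\<close>, which lies outside
        \<open>nodes N\<close>; so the domain of \<open>?R\<close> misses the range of the new
        arrows.\<close>
      ultimately have "wf (?R \<union> nodes N \<times> {v})"
        using \<open>?R \<subseteq> _\<close> v by (intro wf_Un) auto
      then show ?thesis
        by (rule wf_acyclic)
    qed
    ultimately show ?thesis
      unfolding acyclic_network_def by (rule acyclic_subset[rotated])
  qed
  moreover have "flow N' x (t' x)" for x
    unfolding flow_def
  proof
    fix e assume e: "e \<in> edges N'"
    have init: "fst (initial_config N' x) d = fst (initial_config N x) d" for d
      by (simp add: initial_config_def N'_def)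
    have t'_t: "(\<Sum>d\<in>C. t' x d) = (\<Sum>d\<in>C. t x d)" if "C \<subseteq> edges N" for C
      using that Out(3) by (intro sum.cong) (auto simp: t'_def)
    show "t' x e = produced N' x (t' x) e"
    proof (cases "e \<in> Out")
      case True
      then have "e \<notin> range (input_edge N)"
        using inputs Out(3) by blast
      then have "fst (initial_config N x) e = 0"
        by (auto simp: initial_config_def)
      moreover have "tail_of N' e = Some v" "gate_at N' v = g" "initial_state N' v = s"
        using True by (auto simp: N'_def)
      ultimately show ?thesis
        using True Iedges(1) by (simp add: produced_def init in_v t'_t) (simp add: t'_def)
    next
      case False
      then have eN: "e \<in> edges N" and tail: "tail_of N' e = tail_of N e"
        using e by (auto simp: N'_def)
      \<comment> \<open>The tail of an old edge is an old node, and attaching the gate leaves its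
        inputs unchanged.\<close>
      have "in_edges N' u = in_edges N u \<and> gate_at N' u = gate_at N u \<and>
          initial_state N' u = initial_state N u" if "tail_of N e = Some u" for u
        using ends[OF eN] that v in_u[of u] by (auto simp: N'_def)
      then have "produced N' x (t' x) e = produced N x (t x) e"
        by (auto simp: produced_def init tail t'_t in_edges_def split: option.split)
      then show ?thesis
        using t[of x] eN False by (simp add: flow_def t'_def)
    qed
  qed
  moreover have "Out \<union> (D - I) \<subseteq> {e \<in> edges N'. head_of N' e = None}"
    using D by (auto simp: N'_def)
  moreover have "image_mset (\<lambda>e x. t' x e) (mset_set (Out \<union> (D - I))) =
      replicate_mset (num_outputs g) (\<lambda>x. gate_output g s (\<Sum>h\<in>#B. h x)) + A"
  proof -
    have sumB: "(\<Sum>d\<in>I. t x d) = (\<Sum>h\<in>#B. h x)" for x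
      by (simp add: sum_unfold_sum_mset multiset.map_comp comp_def flip: split(2) B')
    have "image_mset (\<lambda>e x. t' x e) (mset_set Out) =
        image_mset (\<lambda>_ x. gate_output g s (\<Sum>h\<in>#B. h x)) (mset_set Out)"
      using Out(1) by (intro image_mset_cong) (simp add: t'_def sumB)
    moreover have "image_mset (\<lambda>e x. t' x e) (mset_set (D - I)) = A"
      unfolding split(3)[symmetric] A'
      using D Out(3) finD by (intro image_mset_cong) (auto simp: t'_def fun_eq_iff)
    moreover have "mset_set (Out \<union> (D - I)) = mset_set Out + mset_set (D - I)"
      using D Out finD by (intro mset_set_Union) auto
    ultimately show ?thesis
      using Out(2) by (simp add: image_mset_const_eq)
  qed
  ultimately show ?thesis
    unfolding available_def by blast
qed

section \<open>Assembling the network of a generated function\<close>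

lemma available_split:
  assumes "available (add_mset f A)"
  shows "available (add_mset f (add_mset f A))"
  using available_gate[of "{#f#}" A Splitter 0] assms
  by (simp add: gate_output_eq numeral_2_eq_2)

text \<open>The pool \<open>A\<close> is arbitrary in the induction, so for a sum one summand can be
  built while the other is already in the pool.\<close>

lemma available_gate_function:
  assumes "gate_function f"
    and "\<And>i. (\<lambda>x. x $ i) \<in># A" and "available A"
  shows "available (add_mset f A)"
  using assms
proof (induction f arbitrary: A)
  case (proj i)
  then obtain A' where "A = add_mset (\<lambda>x. x $ i) A'"
    by (metis multi_member_split)
  then show ?case using available_split proj by metis
next
  case zero
  \<comment> \<open>Some coordinate, here that of the index \<open>undefined\<close>, is duplicated;
    the copy is fed to a presink in state 1, which emits nothing.\<close>
  obtain A' where A: "A = add_mset (\<lambda>x. x $ undefined) A'"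
    using zero(1) by (metis multi_member_split)
  then have "available ({#\<lambda>x. x $ undefined#} + A)"
    using available_split zero(2) by simp
  from available_gate[OF this, of Presink 1] show ?case
    by (simp add: gate_output_eq)
next
  case (add f g)
  have "available ({#f, g#} + A)"
    using add by simp
  from available_gate[OF this, of Adder 0] show ?case
    by (simp add: gate_output_eq)
next
  case (min_1 f)
  then have "available ({#f#} + A)" by simp
  from available_gate[OF this, of Presink 0] show ?case
    by (simp add: gate_output_eq)
next
  case (minus_1 f)
  then have "available ({#f#} + A)" by simp
  from available_gate[OF this, of Delayer 0] show ?case
    by (simp add: gate_output_eq)
qed

text \<open>The flow does not depend on which dangling edge is designated as output, so the
  designation can be moved to the edge that carries \<open>f\<close>; the others become
  trash.\<close>

lemma computes_if_available:
  fixes f :: "nat ^ 'k \<Rightarrow> nat"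
  assumes "available (add_mset f A)"
  shows "\<exists>N :: 'k network. abelian_network N \<and> acyclic_network N \<and> computes N f"
proof -
  obtain N :: "'k network" and t D where N: "abelian_network N" "acyclic_network N"
    and t: "\<And>x. flow N x (t x)" and D: "D \<subseteq> {e \<in> edges N. head_of N e = None}"
    and fA: "image_mset (\<lambda>e x. t x e) (mset_set D) = add_mset f A"
    using assms by (auto simp: available_def)
  have "finite D"
    using D N(1) by (auto simp: abelian_network_def intro: finite_subset)
  moreover have "f \<in># image_mset (\<lambda>e x. t x e) (mset_set D)"
    by (simp add: fA)
  ultimately obtain e where e: "e \<in> D" "f = (\<lambda>x. t x e)"
    by auto
  let ?N = "N\<lparr>output_edge := e\<rparr>"
  have "abelian_network ?N"
    using N(1) D e(1) by (auto simp: abelian_network_def in_edges_def out_edges_def)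
  moreover have "acyclic_network ?N"
    using N(2) by (simp add: acyclic_network_def)
  moreover have "flow ?N x (t x)" for x
    using t[of x]
    by (simp add: flow_def produced_def initial_config_def in_edges_def split: option.split)
  ultimately show ?thesis
    using computes_if_flow[of ?N t f] e(2) by auto
qed

theorem theorem5p3:
  fixes f :: "nat ^ 'k \<Rightarrow> nat"
  shows "(\<exists>N :: 'k network. abelian_network N \<and> acyclic_network N \<and> computes N f) \<longleftrightarrow>
         f 0 = 0 \<and>
         mono f \<and>
         (\<exists>L P. nat_linear L \<and> eventually_constant P \<and>
                (\<forall>x. of_nat (f x) = of_nat (L x) + P x))"
proof -
  have "\<exists>N :: 'k network. abelian_network N \<and> acyclic_network N \<and> computes N f"
    if "linear_plus_constant f"
    using available_gate_function[OF gate_function_if_linear_plus_constant[OF that] _ available_proj]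
    by (intro computes_if_available) auto
  then show ?thesis
    using linear_plus_constant_if_computes unfolding linear_plus_constant_def by blast
qed

end
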